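(* For $n>2$ let $\varphi_n: T_n \to T_{n-1}$ be the surjective homomorphism with $\varphi_n(s_{n-1})=1$ and $\varphi_n(s_i)=s_i$ for $1\le i\le n-2$, and let $D_n=\operatorname{Ker}(\varphi_n)$. Then: (1) $T_n = D_n \rtimes T_{n-1}$ for every $n>2$, i.e. $T_n$ is the semidirect product of the normal subgroup $D_n$ and $T_{n-1}$. (2) $D_3 \cong \mathbb{Z}_2 * \mathbb{Z}_2 \cong T_3$. (3) $D_4 \cong \langle a_k,\ k\in\mathbb{Z} \mid a_k^2=1,\ k\in\mathbb{Z}\rangle$, i.e. $D_4$ is isomorphic to the free product of copies of $\mathbb{Z}_2$ indexed by the integers.
   Context: For an integer $n\ge 2$, the twin group $T_n$ is the group generated by $s_1,\dots,s_{n-1}$ with defining relations $s_i^2=1$ for $1\le i\le n-1$ and $s_is_j=s_js_i$ for $|i-j|\ge 2$. The group $T_{n-1}$ is regarded as the subgroup of $T_n$ generated by $s_1,\dots,s_{n-2}$, via the map $s_i\mapsto s_i$. $\mathbb{Z}_2$ is the cyclic group of order 2 and $*$ denotes the free product. *)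

theory Defs
  imports "HOL-Algebra.Elementary_Groups"
begin

text \<open>
  A letter \<open>(x, True)\<close> stands for the generator \<open>x\<close>, and \<open>(x, False)\<close> for its formal inverse.
\<close>

type_synonym 'a gword = "('a \<times> bool) list"

definition gwords :: "'a set \<Rightarrow> 'a gword set" where
  "gwords X = lists (X \<times> UNIV)"

text \<open>
  The group presented by generators \<open>X\<close> and relations \<open>R\<close> (a pair \<open>(u, v)\<close> stands for the
  relation \<open>u = v\<close>) consists of the words over \<open>X\<close> modulo the least congruence on words that
  contains the free cancellations and the relations. This is the quotient of the free group on
  \<open>X\<close> by the normal closure of the elements \<open>u v\<^sup>-\<^sup>1\<close>.
\<close>

inductive pres_eq :: "'a set \<Rightarrow> ('a gword \<times> 'a gword) set \<Rightarrow> 'a gword \<Rightarrow> 'a gword \<Rightarrow> bool"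
  for X R where
  refl: "w \<in> gwords X \<Longrightarrow> pres_eq X R w w"
| sym: "pres_eq X R u v \<Longrightarrow> pres_eq X R v u"
| trans: "pres_eq X R u v \<Longrightarrow> pres_eq X R v w \<Longrightarrow> pres_eq X R u w"
| cong: "pres_eq X R u u' \<Longrightarrow> pres_eq X R v v' \<Longrightarrow> pres_eq X R (u @ v) (u' @ v')"
| cancel: "x \<in> X \<Longrightarrow> pres_eq X R [(x, b), (x, \<not> b)] []"
| rel: "(u, v) \<in> R \<Longrightarrow> u \<in> gwords X \<Longrightarrow> v \<in> gwords X \<Longrightarrow> pres_eq X R u v"

definition pres_class ::
    "'a set \<Rightarrow> ('a gword \<times> 'a gword) set \<Rightarrow> 'a gword \<Rightarrow> 'a gword set" where
  "pres_class X R w = {v. pres_eq X R w v}"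

definition presented_group ::
    "'a set \<Rightarrow> ('a gword \<times> 'a gword) set \<Rightarrow> 'a gword set monoid" where
  "presented_group X R =
     \<lparr>carrier = pres_class X R ` gwords X,
      mult = (\<lambda>A B. \<Union>a\<in>A. \<Union>b\<in>B. pres_class X R (a @ b)),
      one = pres_class X R []\<rparr>"

lemma pres_eq_gwords: "pres_eq X R u v \<Longrightarrow> u \<in> gwords X \<and> v \<in> gwords X"
  by (induction rule: pres_eq.induct) (auto simp: gwords_def)

lemma pres_class_eq_iff:
  "u \<in> gwords X \<Longrightarrow> pres_class X R u = pres_class X R v \<longleftrightarrow> pres_eq X R u v"
  unfolding pres_class_def set_eq_iff mem_Collect_eq
  by (metis pres_eq.refl pres_eq.sym pres_eq.trans pres_eq_gwords)

lemma presented_group_mult: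
  assumes "u \<in> gwords X" "v \<in> gwords X"
  shows "pres_class X R u \<otimes>\<^bsub>presented_group X R\<^esub> pres_class X R v = pres_class X R (u @ v)"
proof -
  have "pres_class X R (a @ b) = pres_class X R (u @ v)"
    if "a \<in> pres_class X R u" "b \<in> pres_class X R v" for a b
  proof -
    have "pres_eq X R (u @ v) (a @ b)"
      using that by (intro pres_eq.cong) (simp_all add: pres_class_def)
    moreover have "u @ v \<in> gwords X"
      using assms by (simp add: gwords_def)
    ultimately show ?thesis
      using pres_class_eq_iff[of "u @ v" X R "a @ b"] by simp
  qed
  moreover have "u \<in> pres_class X R u" "v \<in> pres_class X R v"
    using assms by (simp_all add: pres_class_def pres_eq.refl)
  ultimately have "(\<Union>a\<in>pres_class X R u. \<Union>b\<in>pres_class X R v. pres_class X R (a @ b)) =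
      pres_class X R (u @ v)"
    by blast
  then show ?thesis
    by (simp add: presented_group_def)
qed

lemma group_presented_group: "group (presented_group X R)"
proof (rule groupI)
  let ?G = "presented_group X R"
  have car: "carrier ?G = pres_class X R ` gwords X"
    and one: "\<one>\<^bsub>?G\<^esub> = pres_class X R []"
    by (simp_all add: presented_group_def)
  have nil: "[] \<in> gwords X"
    by (simp add: gwords_def)
  have app: "u @ v \<in> gwords X" if "u \<in> gwords X" "v \<in> gwords X" for u v
    using that by (simp add: gwords_def)
  show "\<one>\<^bsub>?G\<^esub> \<in> carrier ?G"
    using nil by (simp add: car one)
  show "A \<otimes>\<^bsub>?G\<^esub> B \<in> carrier ?G" if "A \<in> carrier ?G" "B \<in> carrier ?G" for A B
    using that by (auto simp: car presented_group_mult app)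
  show "A \<otimes>\<^bsub>?G\<^esub> B \<otimes>\<^bsub>?G\<^esub> C = A \<otimes>\<^bsub>?G\<^esub> (B \<otimes>\<^bsub>?G\<^esub> C)"
    if "A \<in> carrier ?G" "B \<in> carrier ?G" "C \<in> carrier ?G" for A B C
    using that by (auto simp: car presented_group_mult app)
  show "\<one>\<^bsub>?G\<^esub> \<otimes>\<^bsub>?G\<^esub> A = A" if "A \<in> carrier ?G" for A
    using that by (auto simp: car one presented_group_mult nil)
  have inv: "\<exists>v\<in>gwords X. pres_eq X R (v @ w) []" if "w \<in> gwords X" for w
    using that
  proof (induction w)
    case Nil
    then show ?case using nil pres_eq.refl[OF nil] by (intro bexI[of _ "[]"]) simp_all
  next
    case (Cons l w)
    obtain x b where l: "l = (x, b)" by (cases l)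
    with Cons obtain v where v: "v \<in> gwords X" "pres_eq X R (v @ w) []"
      and x: "x \<in> X" and w: "w \<in> gwords X"
      by (auto simp: gwords_def)
    have "pres_eq X R [(x, \<not> b), (x, b)] []"
      using pres_eq.cancel[OF x, of R "\<not> b"] by simp
    then have "pres_eq X R (v @ [(x, \<not> b), (x, b)] @ w) (v @ [] @ w)"
      using v(1) w by (intro pres_eq.cong pres_eq.refl)
    then have "pres_eq X R ((v @ [(x, \<not> b)]) @ l # w) []"
      using pres_eq.trans[OF _ v(2)] l by simp
    moreover have "v @ [(x, \<not> b)] \<in> gwords X"
      using v(1) x by (simp add: gwords_def)
    ultimately show ?case by blast
  qed
  show "\<exists>B\<in>carrier ?G. B \<otimes>\<^bsub>?G\<^esub> A = \<one>\<^bsub>?G\<^esub>" if "A \<in> carrier ?G" for A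
  proof -
    obtain w where w: "w \<in> gwords X" "A = pres_class X R w"
      using \<open>A \<in> carrier ?G\<close> by (auto simp: car)
    obtain v where v: "v \<in> gwords X" "pres_eq X R (v @ w) []"
      using inv[OF w(1)] by blast
    have "pres_class X R v \<otimes>\<^bsub>?G\<^esub> A = \<one>\<^bsub>?G\<^esub>"
      using v w by (simp add: presented_group_mult one pres_class_eq_iff app)
    then show ?thesis
      using v(1) by (auto simp: car)
  qed
qed

text \<open>
  The free product of the groups \<open>G i\<close>, \<open>i \<in> I\<close>: the generators are the elements of the disjoint
  union of the factors, and the relations are the multiplication tables of the factors.
\<close>

definition free_product ::
    "'i set \<Rightarrow> ('i \<Rightarrow> ('g, 'm) monoid_scheme) \<Rightarrow> ('i \<times> 'g) gword set monoid" where
  "free_product I G =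
     presented_group (SIGMA i:I. carrier (G i))
       {([((i, g), True), ((i, h), True)], [((i, g \<otimes>\<^bsub>G i\<^esub> h), True)]) | i g h.
          i \<in> I \<and> g \<in> carrier (G i) \<and> h \<in> carrier (G i)}"

definition free_product2 ::
    "('g, 'm) monoid_scheme \<Rightarrow> ('g, 'm) monoid_scheme \<Rightarrow> (bool \<times> 'g) gword set monoid" where
  "free_product2 G H = free_product UNIV (\<lambda>b. if b then G else H)"

definition is_semidirect_product ::
    "('g, 'm) monoid_scheme \<Rightarrow> 'g set \<Rightarrow> 'g set \<Rightarrow> bool" where
  "is_semidirect_product G N H \<longleftrightarrow>
     N \<lhd> G \<and> subgroup H G \<and> N \<inter> H = {\<one>\<^bsub>G\<^esub>} \<and> N <#>\<^bsub>G\<^esub> H = carrier G"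

definition twin_rels :: "nat \<Rightarrow> (nat gword \<times> nat gword) set" where
  "twin_rels n =
     {([(i, True), (i, True)], []) | i. i \<in> {1..n - 1}} \<union>
     {([(i, True), (j, True)], [(j, True), (i, True)]) | i j.
        i \<in> {1..n - 1} \<and> j \<in> {1..n - 1} \<and> \<bar>int i - int j\<bar> \<ge> 2}"

definition twin_group :: "nat \<Rightarrow> nat gword set monoid" where
  "twin_group n = presented_group {1..n - 1} (twin_rels n)"

definition twin_gen :: "nat \<Rightarrow> nat \<Rightarrow> nat gword set" where
  "twin_gen n i = pres_class {1..n - 1} (twin_rels n) [(i, True)]"

definition twin_subgroup :: "nat \<Rightarrow> nat gword set set" where
  "twin_subgroup n = generate (twin_group n) (twin_gen n ` {1..n - 2})"

text \<open>
  The conditions determine the values of \<open>\<phi>\<close> on the carrier of \<open>T\<^sub>n\<close>; outside the carrier, \<open>\<phi>\<close>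
  is arbitrary.
\<close>

definition twin_projection :: "nat \<Rightarrow> (nat gword set \<Rightarrow> nat gword set) \<Rightarrow> bool" where
  "twin_projection n \<phi> \<longleftrightarrow>
     \<phi> \<in> epi (twin_group n) (twin_group (n - 1)) \<and>
     \<phi> (twin_gen n (n - 1)) = \<one>\<^bsub>twin_group (n - 1)\<^esub> \<and>
     (\<forall>i\<in>{1..n - 2}. \<phi> (twin_gen n i) = twin_gen (n - 1) i)"

definition twin_kernel :: "nat \<Rightarrow> (nat gword set \<Rightarrow> nat gword set) \<Rightarrow> nat gword set set" where
  "twin_kernel n \<phi> = kernel (twin_group n) (twin_group (n - 1)) \<phi>"

definition twin_kernel_group ::
    "nat \<Rightarrow> (nat gword set \<Rightarrow> nat gword set) \<Rightarrow> nat gword set monoid" where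
  "twin_kernel_group n \<phi> = (twin_group n)\<lparr>carrier := twin_kernel n \<phi>\<rparr>"

end

theory Submission
  imports Defs "HOL-Algebra.Bij"
begin

text \<open>
  The inclusion of \<open>T\<^bsub>n-1\<^esub>\<close> is a section of the projection, which gives the semidirect product. The
  kernel consists of the products of conjugates of \<open>s\<^bsub>n-1\<^esub>\<close> under \<open>T\<^bsub>n-1\<^esub>\<close>. For \<open>n = 3\<close> these are \<open>s\<^sub>2\<close>
  and \<open>s\<^sub>1 s\<^sub>2 s\<^sub>1\<close>. For \<open>n = 4\<close> let \<open>r = s\<^sub>1 s\<^sub>2\<close>; since \<open>s\<^sub>1\<close> commutes with \<open>s\<^sub>3\<close> and inverts \<open>r\<close>, they
  are \<open>a\<^sub>k = r\<^sup>k s\<^sub>3 r\<^bsup>-k\<^esup>\<close>, and conjugation by \<open>s\<^sub>1\<close> and \<open>s\<^sub>2\<close> maps \<open>k\<close> to \<open>-k\<close> and \<open>-k - 1\<close>. Conversely,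
  \<open>T\<^sub>n\<close> acts on the free product of copies of \<open>\<int>\<^sub>2\<close> in such a way that the conjugates of \<open>s\<^bsub>n-1\<^esub>\<close> act
  by left multiplication with the generators, so that they satisfy no further relations.
\<close>

section \<open>Presented groups\<close>

abbreviation pres_gen :: "'a set \<Rightarrow> ('a gword \<times> 'a gword) set \<Rightarrow> 'a \<Rightarrow> 'a gword set" where
  "pres_gen X R x \<equiv> pres_class X R [(x, True)]"

fun word_eval :: "('g, 'm) monoid_scheme \<Rightarrow> ('a \<Rightarrow> 'g) \<Rightarrow> 'a gword \<Rightarrow> 'g" where
  "word_eval G f [] = \<one>\<^bsub>G\<^esub>"
| "word_eval G f ((x, b) # w) = (if b then f x else inv\<^bsub>G\<^esub> f x) \<otimes>\<^bsub>G\<^esub> word_eval G f w"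

lemma gwords_simps [simp]:
  "[] \<in> gwords X"
  "(x, b) # w \<in> gwords X \<longleftrightarrow> x \<in> X \<and> w \<in> gwords X"
  "u @ v \<in> gwords X \<longleftrightarrow> u \<in> gwords X \<and> v \<in> gwords X"
  by (auto simp: gwords_def)

context group
begin

lemma word_eval_closed [simp]:
  assumes "f \<in> X \<rightarrow> carrier G" and "w \<in> gwords X"
  shows "word_eval G f w \<in> carrier G"
  using assms(2)
proof (induction w)
  case (Cons l w)
  obtain x b where "l = (x, b)" by (cases l)
  with Cons assms(1) show ?case by (auto simp: Pi_iff)
qed simp

lemma word_eval_append:
  assumes "f \<in> X \<rightarrow> carrier G" and "u \<in> gwords X" and "v \<in> gwords X"
  shows "word_eval G f (u @ v) = word_eval G f u \<otimes> word_eval G f v"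
  using assms(2)
proof (induction u)
  case Nil
  with assms show ?case by simp
next
  case (Cons l u)
  obtain x b where l: "l = (x, b)" by (cases l)
  with Cons.prems assms(1) have "f x \<in> carrier G" "u \<in> gwords X" by auto
  with Cons assms l show ?case by (simp add: m_assoc)
qed

text \<open>Having equal values is a congruence on words that contains the cancellations and, by
  assumption, the relations. \<open>pres_eq\<close> is the least such congruence.\<close>

lemma word_eval_pres_eq:
  assumes f: "f \<in> X \<rightarrow> carrier G"
    and R: "\<And>u v. (u, v) \<in> R \<Longrightarrow> u \<in> gwords X \<Longrightarrow> v \<in> gwords X \<Longrightarrow>
      word_eval G f u = word_eval G f v"
    and "pres_eq X R u v"
  shows "word_eval G f u = word_eval G f v"
  using assms(3)
proof (induction rule: pres_eq.induct)
  case (cong u u' v v')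
  with f show ?case
    using pres_eq_gwords by (metis word_eval_append)
next
  case (cancel x b)
  with f have "f x \<in> carrier G" by auto
  then show ?case by (cases b) auto
qed (use R in auto)

text \<open>Existence half of the universal property of a presentation: evaluation is constant on
  congruence classes and so descends to the quotient.\<close>

lemma presented_group_lift:
  assumes f: "f \<in> X \<rightarrow> carrier G"
    and R: "\<And>u v. (u, v) \<in> R \<Longrightarrow> u \<in> gwords X \<Longrightarrow> v \<in> gwords X \<Longrightarrow>
      word_eval G f u = word_eval G f v"
  shows "\<exists>h \<in> hom (presented_group X R) G. \<forall>x\<in>X. h (pres_gen X R x) = f x"
proof -
  \<comment> \<open>A class is evaluated at a chosen representative;
    \<open>word_eval_pres_eq\<close> makes the choice irrelevant.\<close>
  define h where "h A = word_eval G f (SOME w. w \<in> A)" for A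
  have h: "h (pres_class X R w) = word_eval G f w" if "w \<in> gwords X" for w
  proof -
    have "w \<in> pres_class X R w"
      using that by (simp add: pres_class_def pres_eq.refl)
    then have "(SOME v. v \<in> pres_class X R w) \<in> pres_class X R w"
      by (rule someI)
    then have "pres_eq X R w (SOME v. v \<in> pres_class X R w)"
      by (simp add: pres_class_def)
    from word_eval_pres_eq[OF f R this] show ?thesis
      by (simp add: h_def)
  qed
  have car: "carrier (presented_group X R) = pres_class X R ` gwords X"
    by (simp add: presented_group_def)
  have "h \<in> hom (presented_group X R) G"
    using f by (intro homI) (auto simp: car h presented_group_mult word_eval_append)
  moreover have "\<forall>x\<in>X. h (pres_gen X R x) = f x"
    using f by (auto simp: h Pi_iff)
  ultimately show ?thesis by blast
qed

end

lemma pres_gen_closed [simp]: "x \<in> X \<Longrightarrow> pres_gen X R x \<in> carrier (presented_group X R)"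
  by (simp add: presented_group_def)

lemma pres_class_rel:
  assumes "(u, v) \<in> R" "u \<in> gwords X" "v \<in> gwords X"
  shows "pres_class X R u = pres_class X R v"
  using assms by (simp add: pres_class_eq_iff pres_eq.rel)

text \<open>A word is the product of its letters, and cancellation identifies the letter
  \<open>(x, False)\<close> with the inverse of the generator \<open>x\<close>.\<close>

lemma generate_presented_group:
  "generate (presented_group X R) (pres_gen X R ` X) = carrier (presented_group X R)"
proof
  interpret group "presented_group X R"
    by (rule group_presented_group)
  let ?H = "generate (presented_group X R) (pres_gen X R ` X)"
  show "?H \<subseteq> carrier (presented_group X R)"
    by (rule generate_incl) auto
  have letter: "pres_class X R [(x, b)] \<in> ?H" if x: "x \<in> X" for x b
  proof (cases b)
    case True
    with x show ?thesis by (auto intro: generate.incl)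
  next
    case False
    have "pres_eq X R [(x, False), (x, True)] []"
      using pres_eq.cancel[OF x, of R False] by simp
    then have "pres_class X R [(x, False)] \<otimes>\<^bsub>presented_group X R\<^esub> pres_gen X R x =
        \<one>\<^bsub>presented_group X R\<^esub>"
      using x by (simp add: presented_group_mult pres_class_eq_iff) (simp add: presented_group_def pres_class_eq_iff)
    then have "pres_class X R [(x, False)] = inv\<^bsub>presented_group X R\<^esub> pres_gen X R x"
      using x by (intro inv_equality[symmetric]) (auto simp: presented_group_def)
    with x False show ?thesis by (auto intro: generate.inv)
  qed
  have "pres_class X R w \<in> ?H" if "w \<in> gwords X" for w
    using that
  proof (induction w)
    case Nil
    show ?case
      using generate.one[of "presented_group X R"] by (simp add: presented_group_def)
  next
    case (Cons l w)
    obtain x b where l: "l = (x, b)" by (cases l)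
    with Cons.prems have "pres_class X R (l # w) =
        pres_class X R [(x, b)] \<otimes>\<^bsub>presented_group X R\<^esub> pres_class X R w"
      by (simp add: presented_group_mult)
    with Cons l letter show ?case by (auto intro: generate.eng)
  qed
  then show "carrier (presented_group X R) \<subseteq> ?H"
    by (auto simp: presented_group_def)
qed

lemma hom_eq_on_generate:
  assumes G: "group G" and H: "group H" and h: "h \<in> hom G H" "k \<in> hom G H"
    and S: "S \<subseteq> carrier G" and eq: "\<And>x. x \<in> S \<Longrightarrow> h x = k x"
    and x: "x \<in> generate G S"
  shows "h x = k x"
proof -
  interpret h: group_hom G H h using G H h by (simp add: group_hom_def group_hom_axioms_def)
  interpret k: group_hom G H k using G H h by (simp add: group_hom_def group_hom_axioms_def)
  from x show ?thesis
  proof (induction rule: generate.induct)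
    case (inv x)
    with S eq show ?case by (metis h.hom_inv k.hom_inv subsetD)
  next
    case (eng x y)
    with S show ?case by (metis h.hom_mult k.hom_mult h.G.generate_in_carrier)
  qed (use eq in auto)
qed

text \<open>Uniqueness half of the universal property, since the generators generate the
  group.\<close>

lemma presented_group_hom_eq:
  assumes "group H" "h \<in> hom (presented_group X R) H" "k \<in> hom (presented_group X R) H"
    and "\<And>x. x \<in> X \<Longrightarrow> h (pres_gen X R x) = k (pres_gen X R x)"
    and "g \<in> carrier (presented_group X R)"
  shows "h g = k g"
proof (rule hom_eq_on_generate[OF group_presented_group assms(1-3)])
  show "g \<in> generate (presented_group X R) (pres_gen X R ` X)"
    using assms(5) by (simp only: generate_presented_group)
qed (use assms(4) in auto)

text \<open>Both composites agree with the identity on generators, hence everywhere, so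
  \<open>h\<close> and \<open>k\<close> are mutually inverse.\<close>

lemma presented_group_isoI:
  assumes h: "h \<in> hom (presented_group X R) (presented_group Y S)"
    and k: "k \<in> hom (presented_group Y S) (presented_group X R)"
    and kh: "\<And>x. x \<in> X \<Longrightarrow> k (h (pres_gen X R x)) = pres_gen X R x"
    and hk: "\<And>y. y \<in> Y \<Longrightarrow> h (k (pres_gen Y S y)) = pres_gen Y S y"
  shows "presented_group X R \<cong> presented_group Y S"
proof -
  have "k (h g) = g" if "g \<in> carrier (presented_group X R)" for g
    using presented_group_hom_eq[OF group_presented_group hom_compose[OF h k]
        id_iso[unfolded iso_def, THEN CollectD, THEN conjunct1] _ that] kh by simp
  moreover have "h (k g) = g" if "g \<in> carrier (presented_group Y S)" for g
    using presented_group_hom_eq[OF group_presented_group hom_compose[OF k h]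
        id_iso[unfolded iso_def, THEN CollectD, THEN conjunct1] _ that] hk by simp
  moreover have "h ` carrier (presented_group X R) \<subseteq> carrier (presented_group Y S)"
    "k ` carrier (presented_group Y S) \<subseteq> carrier (presented_group X R)"
    using h k by (auto simp: hom_def)
  ultimately have "bij_betw h (carrier (presented_group X R)) (carrier (presented_group Y S))"
    by (intro bij_betw_byWitness[where f' = k]) auto
  with h show ?thesis by (auto intro!: is_isoI simp: iso_def)
qed

section \<open>Free products of groups of order two\<close>

definition involution_rels :: "'a set \<Rightarrow> ('a gword \<times> 'a gword) set" where
  "involution_rels X = {([(x, True), (x, True)], []) | x. x \<in> X}"

text \<open>The free product of copies of \<int>/2 indexed by \<open>X\<close>, in the presentation
  with one generator per factor. Both kernels are first identified with such a group.\<close>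

definition involution_group :: "'a set \<Rightarrow> 'a gword set monoid" where
  "involution_group X = presented_group X (involution_rels X)"

definition involution_gen :: "'a set \<Rightarrow> 'a \<Rightarrow> 'a gword set" where
  "involution_gen X = pres_gen X (involution_rels X)"

lemma group_involution_group: "group (involution_group X)"
  by (simp add: involution_group_def group_presented_group)

lemma involution_gen_closed [simp]:
  "x \<in> X \<Longrightarrow> involution_gen X x \<in> carrier (involution_group X)"
  by (simp add: involution_group_def involution_gen_def)

lemma involution_gen_square:
  assumes "x \<in> X"
  shows "involution_gen X x \<otimes>\<^bsub>involution_group X\<^esub> involution_gen X x =
    \<one>\<^bsub>involution_group X\<^esub>"
proof -
  have "pres_class X (involution_rels X) [(x, True), (x, True)] = pres_class X (involution_rels X) []"
    using assms by (intro pres_class_rel) (auto simp: involution_rels_def)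
  with assms show ?thesis
    by (simp add: involution_group_def involution_gen_def presented_group_mult)
       (simp add: presented_group_def)
qed

lemma (in group) involution_group_lift:
  assumes "\<And>x. x \<in> X \<Longrightarrow> f x \<in> carrier G" "\<And>x. x \<in> X \<Longrightarrow> f x \<otimes> f x = \<one>"
  shows "\<exists>h \<in> hom (involution_group X) G. \<forall>x\<in>X. h (involution_gen X x) = f x"
  unfolding involution_group_def involution_gen_def
  using assms by (intro presented_group_lift) (auto simp: involution_rels_def)

lemma involution_group_hom_eq:
  assumes "group H" "h \<in> hom (involution_group X) H" "k \<in> hom (involution_group X) H"
    and "\<And>x. x \<in> X \<Longrightarrow> h (involution_gen X x) = k (involution_gen X x)"
    and "g \<in> carrier (involution_group X)"
  shows "h g = k g"
  using assms unfolding involution_group_def involution_gen_def by (rule presented_group_hom_eq)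

text \<open>The free product has two generators \<open>(x, 0)\<close> and \<open>(x, 1)\<close> per
  factor. Its multiplication tables make the first trivial and the second an involution, so only
  \<open>(x, 1)\<close> survives.\<close>

lemma involution_group_cong_free_product:
  "involution_group X \<cong> free_product X (\<lambda>_. integer_mod_group 2)"
proof -
  let ?Z = "integer_mod_group 2"
  define Y where "Y = (SIGMA i:X. carrier ?Z)"
  define S where "S = {([((i, g), True), ((i, h), True)], [((i, g \<otimes>\<^bsub>?Z\<^esub> h), True)]) | i g h.
      i \<in> X \<and> g \<in> carrier ?Z \<and> h \<in> carrier ?Z}"
  let ?F = "presented_group Y S"
  have F: "free_product X (\<lambda>_. ?Z) = ?F"
    by (simp add: free_product_def Y_def S_def)
  interpret F: group ?F by (rule group_presented_group)
  interpret P: group "involution_group X" by (rule group_involution_group)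
  have Y: "(x, g) \<in> Y \<longleftrightarrow> x \<in> X \<and> (g = 0 \<or> g = 1)" for x g
    by (auto simp: Y_def carrier_integer_mod_group)
  have mult: "pres_gen Y S (x, g) \<otimes>\<^bsub>?F\<^esub> pres_gen Y S (x, h) = pres_gen Y S (x, (g + h) mod 2)"
    if "x \<in> X" "g \<in> carrier ?Z" "h \<in> carrier ?Z" for x g h
  proof -
    have "pres_class Y S [((x, g), True), ((x, h), True)] = pres_gen Y S (x, (g + h) mod 2)"
      using that by (intro pres_class_rel) (auto simp: S_def Y_def carrier_integer_mod_group)
    with that show ?thesis by (simp add: presented_group_mult Y_def)
  qed
  \<comment> \<open>The table entry 0 + 0 = 0 makes this generator idempotent, hence
    neutral.\<close>
  have zero: "pres_gen Y S (x, 0) = \<one>\<^bsub>?F\<^esub>" if "x \<in> X" for x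
    using mult[OF that, of 0 0] that
    by (metis F.l_cancel_one Y add_0 integer_mod_group_0 mod_0 pres_gen_closed)
  have square: "pres_gen Y S (x, 1) \<otimes>\<^bsub>?F\<^esub> pres_gen Y S (x, 1) = \<one>\<^bsub>?F\<^esub>" if "x \<in> X" for x
    using mult[OF that, of 1 1] zero[OF that] by simp
  obtain h where h: "h \<in> hom (involution_group X) ?F"
    "\<And>x. x \<in> X \<Longrightarrow> h (involution_gen X x) = pres_gen Y S (x, 1)"
    using F.involution_group_lift[of X "\<lambda>x. pres_gen Y S (x, 1)"] square by (auto simp: Y)
  \<comment> \<open>The images under the inverse map. The table entry 1 + 1 = 0 turns into the
    relation that the generator \<open>x\<close> squares to one.\<close>
  define f where "f = (\<lambda>(x, g :: int). if g = 0 then \<one>\<^bsub>involution_group X\<^esub> else involution_gen X x)"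
  have "\<exists>k \<in> hom ?F (involution_group X). \<forall>y\<in>Y. k (pres_gen Y S y) = f y"
    by (rule P.presented_group_lift)
       (auto simp: Y f_def S_def carrier_integer_mod_group involution_gen_square)
  then obtain k where k: "k \<in> hom ?F (involution_group X)"
    "\<And>y. y \<in> Y \<Longrightarrow> k (pres_gen Y S y) = f y"
    by blast
  interpret h: group_hom "involution_group X" ?F h
    using h(1) by unfold_locales
  have "involution_group X \<cong> ?F"
    using h k zero unfolding involution_group_def involution_gen_def
    by (intro presented_group_isoI[of h _ _ _ _ k]) (auto simp: Y f_def h.hom_one[unfolded involution_group_def] involution_gen_def)
  then show ?thesis by (simp only: F)
qed

text \<open>Renaming the generators along \<open>f\<close> and back along its inverse preserves the
  relations. This later replaces the index set of the generators of \<open>twin_group 3\<close> by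
  \<open>bool\<close>.\<close>

lemma involution_group_cong_bij:
  assumes "bij_betw f X Y"
  shows "involution_group X \<cong> involution_group Y"
proof -
  interpret X: group "involution_group X" by (rule group_involution_group)
  interpret Y: group "involution_group Y" by (rule group_involution_group)
  have f: "f x \<in> Y" "inv_into X f (f x) = x" if "x \<in> X" for x
    using assms that by (auto simp: bij_betw_def)
  have g: "inv_into X f y \<in> X" "f (inv_into X f y) = y" if "y \<in> Y" for y
    using assms that by (auto simp: bij_betw_def inv_into_into f_inv_into_f)
  obtain h where h: "h \<in> hom (involution_group X) (involution_group Y)"
    "\<And>x. x \<in> X \<Longrightarrow> h (involution_gen X x) = involution_gen Y (f x)"
    using Y.involution_group_lift[of X "\<lambda>x. involution_gen Y (f x)"] f
    by (auto simp: involution_gen_square)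
  obtain k where k: "k \<in> hom (involution_group Y) (involution_group X)"
    "\<And>y. y \<in> Y \<Longrightarrow> k (involution_gen Y y) = involution_gen X (inv_into X f y)"
    using X.involution_group_lift[of Y "\<lambda>y. involution_gen X (inv_into X f y)"] g
    by (auto simp: involution_gen_square)
  show ?thesis
    using h k f g unfolding involution_group_def involution_gen_def
    by (intro presented_group_isoI[of h _ _ _ _ k]) auto
qed

section \<open>Twin groups\<close>

lemma group_twin_group: "group (twin_group n)"
  by (simp add: twin_group_def group_presented_group)

lemma twin_gen_closed [simp]: "i \<in> {1..n - 1} \<Longrightarrow> twin_gen n i \<in> carrier (twin_group n)"
  unfolding twin_group_def twin_gen_def by (rule pres_gen_closed)

lemma twin_gen_square:
  assumes "i \<in> {1..n - 1}"
  shows "twin_gen n i \<otimes>\<^bsub>twin_group n\<^esub> twin_gen n i = \<one>\<^bsub>twin_group n\<^esub>"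
proof -
  have "pres_class {1..n - 1} (twin_rels n) [(i, True), (i, True)] = pres_class {1..n - 1} (twin_rels n) []"
    using assms by (intro pres_class_rel) (auto simp: twin_rels_def)
  with assms show ?thesis
    by (simp add: twin_group_def twin_gen_def presented_group_mult) (simp add: presented_group_def)
qed

lemma twin_gen_commute:
  assumes "i \<in> {1..n - 1}" "j \<in> {1..n - 1}" "\<bar>int i - int j\<bar> \<ge> 2"
  shows "twin_gen n i \<otimes>\<^bsub>twin_group n\<^esub> twin_gen n j = twin_gen n j \<otimes>\<^bsub>twin_group n\<^esub> twin_gen n i"
proof -
  have "pres_class {1..n - 1} (twin_rels n) [(i, True), (j, True)] =
      pres_class {1..n - 1} (twin_rels n) [(j, True), (i, True)]"
    using assms by (intro pres_class_rel) (auto simp: twin_rels_def)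
  with assms show ?thesis
    by (simp add: twin_group_def twin_gen_def presented_group_mult)
qed

text \<open>The universal property of the twin group; the projection, the inclusion and the action
  on the free product all come from it.\<close>

lemma (in group) twin_group_lift:
  assumes closed: "\<And>i. i \<in> {1..n - 1} \<Longrightarrow> f i \<in> carrier G"
    and "\<And>i. i \<in> {1..n - 1} \<Longrightarrow> f i \<otimes> f i = \<one>"
    and "\<And>i j. i \<in> {1..n - 1} \<Longrightarrow> j \<in> {1..n - 1} \<Longrightarrow> \<bar>int i - int j\<bar> \<ge> 2 \<Longrightarrow>
      f i \<otimes> f j = f j \<otimes> f i"
  shows "\<exists>h \<in> hom (twin_group n) G. \<forall>i\<in>{1..n - 1}. h (twin_gen n i) = f i"
  unfolding twin_group_def twin_gen_def
proof (rule presented_group_lift)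
  show "f \<in> {1..n - 1} \<rightarrow> carrier G" using closed by blast
  show "word_eval G f u = word_eval G f v" if "(u, v) \<in> twin_rels n" for u v
    using that assms unfolding twin_rels_def by (auto simp del: atLeastAtMost_iff)
qed

lemma generate_twin_group:
  "generate (twin_group n) (twin_gen n ` {1..n - 1}) = carrier (twin_group n)"
  using generate_presented_group[of "{1..n - 1}" "twin_rels n"]
  by (simp add: twin_group_def twin_gen_def[abs_def])

lemma twin_group_hom_eq:
  assumes "group H" "h \<in> hom (twin_group n) H" "k \<in> hom (twin_group n) H"
    and "\<And>i. i \<in> {1..n - 1} \<Longrightarrow> h (twin_gen n i) = k (twin_gen n i)"
    and "g \<in> carrier (twin_group n)"
  shows "h g = k g"
  using assms unfolding twin_group_def twin_gen_def by (rule presented_group_hom_eq)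

text \<open>Sending the last generator to the neutral element respects every relation. The image is
  a subgroup containing all generators of the smaller group, which gives surjectivity.\<close>

lemma twin_projection_exists:
  assumes n: "n > 2"
  shows "\<exists>\<phi>. twin_projection n \<phi>"
proof -
  let ?T = "twin_group n" and ?U = "twin_group (n - 1)"
  interpret T: group ?T by (rule group_twin_group)
  interpret U: group ?U by (rule group_twin_group)
  \<comment> \<open>The generators of \<open>twin_group (n - 1)\<close> end at index
    \<open>n - 2\<close>, so the index \<open>n - 1\<close> needs its own value.\<close>
  define f where "f i = (if i = n - 1 then \<one>\<^bsub>?U\<^esub> else twin_gen (n - 1) i)" for i
  have gen: "f i = twin_gen (n - 1) i \<and> i \<in> {1..n - 1 - 1}" if "i \<in> {1..n - 1}" "i \<noteq> n - 1" for i
    using that by (auto simp: f_def)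
  have f: "f i \<in> carrier ?U \<and> f i \<otimes>\<^bsub>?U\<^esub> f i = \<one>\<^bsub>?U\<^esub>" if "i \<in> {1..n - 1}" for i
  proof (cases "i = n - 1")
    case True
    then show ?thesis by (simp add: f_def del: One_nat_def)
  next
    case False
    from gen[OF that False] twin_gen_closed twin_gen_square show ?thesis by metis
  qed
  have "f i \<otimes>\<^bsub>?U\<^esub> f j = f j \<otimes>\<^bsub>?U\<^esub> f i"
    if "i \<in> {1..n - 1}" "j \<in> {1..n - 1}" "\<bar>int i - int j\<bar> \<ge> 2" for i j
  proof (cases "i = n - 1 \<or> j = n - 1")
    case True
    with f[OF that(1)] f[OF that(2)] show ?thesis
      using that(3) by (auto simp: f_def simp del: One_nat_def)
  next
    case False
    with gen[OF that(1)] gen[OF that(2)] that(3) twin_gen_commute show ?thesis by metis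
  qed
  with f have "\<exists>h \<in> hom ?T ?U. \<forall>i\<in>{1..n - 1}. h (twin_gen n i) = f i"
    by (intro U.twin_group_lift) blast+
  then obtain h where h: "h \<in> hom ?T ?U" "\<And>i. i \<in> {1..n - 1} \<Longrightarrow> h (twin_gen n i) = f i"
    by blast
  interpret h: group_hom ?T ?U h using h(1) by unfold_locales
  have h': "h (twin_gen n i) = twin_gen (n - 1) i" if "i \<in> {1..n - 2}" for i
  proof -
    have "i \<in> {1..n - 1}" "i \<noteq> n - 1" using that n by auto
    with h(2) gen show ?thesis by metis
  qed
  have "twin_gen (n - 1) ` {1..n - 1 - 1} \<subseteq> h ` carrier ?T"
  proof (intro image_subsetI image_eqI)
    fix i assume "i \<in> {1..n - 1 - 1}"
    then show "twin_gen (n - 1) i = h (twin_gen n i)" "twin_gen n i \<in> carrier ?T"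
      using h'[of i] by (auto simp del: One_nat_def)
  qed
  then have "carrier ?U \<subseteq> h ` carrier ?T"
    using U.generate_subgroup_incl[OF _ h.img_is_subgroup] generate_twin_group[of "n - 1"] by metis
  then have "h ` carrier ?T = carrier ?U" by (auto simp del: One_nat_def)
  with h(1) h' h(2)[of "n - 1"] n have "twin_projection n h"
    by (simp add: twin_projection_def epi_def f_def)
  then show ?thesis by blast
qed

text \<open>Every defining relation of the smaller twin group is also one of the larger.\<close>

lemma twin_inclusion_exists:
  "\<exists>\<iota> \<in> hom (twin_group (n - 1)) (twin_group n).
    \<forall>i\<in>{1..n - 2}. \<iota> (twin_gen (n - 1) i) = twin_gen n i"
proof -
  interpret T: group "twin_group n" by (rule group_twin_group)
  have mem: "i \<in> {1..n - 1 - 1} \<Longrightarrow> i \<in> {1..n - 1}" for i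
    by auto
  have "\<exists>\<iota> \<in> hom (twin_group (n - 1)) (twin_group n).
      \<forall>i\<in>{1..n - 1 - 1}. \<iota> (twin_gen (n - 1) i) = twin_gen n i"
    by (rule T.twin_group_lift)
      (erule mem[THEN twin_gen_closed] mem[THEN twin_gen_square]
        | rule twin_gen_commute; (erule mem | assumption))+
  moreover have "n - 1 - 1 = n - 2" by simp
  ultimately show ?thesis by simp
qed

text \<open>The composite fixes each generator, so it is the identity: \<iota> is a section of
  \<phi>.\<close>

lemma twin_projection_inclusion:
  assumes "twin_projection n \<phi>"
    and \<iota>: "\<iota> \<in> hom (twin_group (n - 1)) (twin_group n)"
      "\<forall>i\<in>{1..n - 2}. \<iota> (twin_gen (n - 1) i) = twin_gen n i"
    and t: "t \<in> carrier (twin_group (n - 1))"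
  shows "\<phi> (\<iota> t) = t"
proof -
  have \<phi>: "\<phi> \<in> hom (twin_group n) (twin_group (n - 1))"
    "\<forall>i\<in>{1..n - 2}. \<phi> (twin_gen n i) = twin_gen (n - 1) i"
    using assms(1) by (auto simp: twin_projection_def epi_def)
  have "n - 1 - 1 = n - 2" by simp
  with \<phi>(2) \<iota>(2) have "(\<phi> \<circ> \<iota>) t = id t"
    by (intro twin_group_hom_eq[OF group_twin_group hom_compose[OF \<iota>(1) \<phi>(1)] _ _ t])
      (auto simp: hom_def)
  then show ?thesis by simp
qed

text \<open>A homomorphism maps the subgroup generated by a set onto the subgroup generated by its
  image.\<close>

lemma twin_inclusion_image:
  assumes \<iota>: "\<iota> \<in> hom (twin_group (n - 1)) (twin_group n)"
      "\<forall>i\<in>{1..n - 2}. \<iota> (twin_gen (n - 1) i) = twin_gen n i"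
  shows "\<iota> ` carrier (twin_group (n - 1)) = twin_subgroup n"
proof -
  interpret \<iota>: group_hom "twin_group (n - 1)" "twin_group n" \<iota>
    using \<iota>(1) by (simp add: group_hom_def group_hom_axioms_def group_twin_group)
  have n: "n - 1 - 1 = n - 2" by simp
  have "twin_gen (n - 1) ` {1..n - 2} \<subseteq> carrier (twin_group (n - 1))"
    using twin_gen_closed[of _ "n - 1"] n by auto
  from \<iota>.generate_img[OF this] have "\<iota> ` carrier (twin_group (n - 1)) =
      generate (twin_group n) (\<iota> ` twin_gen (n - 1) ` {1..n - 2})"
    using generate_twin_group[of "n - 1"] n by simp
  also have "\<iota> ` twin_gen (n - 1) ` {1..n - 2} = twin_gen n ` {1..n - 2}"
    using \<iota>(2) by (force simp: image_image)
  finally show ?thesis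
    by (simp add: twin_subgroup_def)
qed

text \<open>Injectivity follows from the left inverse \<phi>. This justifies treating the smaller
  twin group as a subgroup.\<close>

lemma twin_inclusion_iso:
  assumes n: "n > 2"
    and \<iota>: "\<iota> \<in> hom (twin_group (n - 1)) (twin_group n)"
      "\<forall>i\<in>{1..n - 2}. \<iota> (twin_gen (n - 1) i) = twin_gen n i"
  shows "\<iota> \<in> iso (twin_group (n - 1)) ((twin_group n)\<lparr>carrier := twin_subgroup n\<rparr>)"
proof -
  obtain \<phi> where "twin_projection n \<phi>"
    using twin_projection_exists[OF n] by blast
  then have "inj_on \<iota> (carrier (twin_group (n - 1)))"
    using twin_projection_inclusion[OF _ \<iota>] by (intro inj_on_inverseI[where g = \<phi>])
  with \<iota>(1) twin_inclusion_image[OF \<iota>] show ?thesis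
    by (auto simp: iso_def bij_betw_def hom_def)
qed

text \<open>The standard splitting argument: a section of \<phi> gives a complement to the kernel.
  If \<open>\<iota> t\<close> lies in the kernel, then \<open>t = \<phi> (\<iota> t)\<close> is
  trivial.\<close>

lemma twin_group_semidirect:
  assumes \<phi>: "twin_projection n \<phi>"
  shows "is_semidirect_product (twin_group n) (twin_kernel n \<phi>) (twin_subgroup n)"
proof -
  let ?T = "twin_group n" and ?U = "twin_group (n - 1)" and ?D = "twin_kernel n \<phi>"
  interpret \<phi>: group_hom ?T ?U \<phi>
    using \<phi> by (simp add: group_hom_def group_hom_axioms_def group_twin_group twin_projection_def epi_def)
  obtain \<iota> where \<iota>: "\<iota> \<in> hom ?U ?T" "\<forall>i\<in>{1..n - 2}. \<iota> (twin_gen (n - 1) i) = twin_gen n i"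
    using twin_inclusion_exists[of n] by blast
  interpret \<iota>: group_hom ?U ?T \<iota>
    using \<iota>(1) by unfold_locales
  note \<phi>\<iota> = twin_projection_inclusion[OF \<phi> \<iota>]
  have H: "twin_subgroup n = \<iota> ` carrier ?U"
    using twin_inclusion_image[OF \<iota>] by simp
  have D: "?D = {x \<in> carrier ?T. \<phi> x = \<one>\<^bsub>?U\<^esub>}"
    by (simp add: twin_kernel_def kernel_def)
  have "?D \<inter> twin_subgroup n = {\<one>\<^bsub>?T\<^esub>}"
    using \<phi>\<iota> subgroup.one_closed[OF \<iota>.img_is_subgroup]
    by (auto simp: H D simp del: One_nat_def)
  moreover have "x \<in> ?D <#>\<^bsub>?T\<^esub> twin_subgroup n" if x: "x \<in> carrier ?T" for x
  proof -
    \<comment> \<open>Since \<phi> takes the same value at \<open>x\<close> and at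
      \<open>?h\<close>, their quotient lies in the kernel.\<close>
    let ?h = "\<iota> (\<phi> x)"
    have "x \<otimes>\<^bsub>?T\<^esub> inv\<^bsub>?T\<^esub> ?h \<in> ?D"
      using x by (simp add: D \<phi>\<iota> del: One_nat_def)
    moreover have "x = x \<otimes>\<^bsub>?T\<^esub> inv\<^bsub>?T\<^esub> ?h \<otimes>\<^bsub>?T\<^esub> ?h"
      using x by (simp add: \<phi>.G.m_assoc del: One_nat_def)
    moreover have "?h \<in> twin_subgroup n"
      using x by (auto simp: H simp del: One_nat_def)
    ultimately show ?thesis
      unfolding set_mult_def by blast
  qed
  moreover have "?D <#>\<^bsub>?T\<^esub> twin_subgroup n \<subseteq> carrier ?T"
    by (auto simp: set_mult_def H D simp del: One_nat_def)
  ultimately show ?thesis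
    using \<phi>.normal_kernel \<iota>.img_is_subgroup
    by (auto simp: is_semidirect_product_def twin_kernel_def H)
qed

section \<open>The kernel of the projection\<close>

text \<open>Cayley's representation; the translations are restricted because \<open>Bij\<close>
  contains only extensional functions.\<close>

lemma (in group) left_mult_hom_BijGroup:
  "(\<lambda>g. \<lambda>x\<in>carrier G. g \<otimes> x) \<in> hom G (BijGroup (carrier G))"
proof -
  have "(\<lambda>x\<in>carrier G. g \<otimes> x) \<in> Bij (carrier G)" if g: "g \<in> carrier G" for g
    using g bij_betw_byWitness[of "carrier G" "\<lambda>x. inv g \<otimes> x" "\<lambda>x. g \<otimes> x" "carrier G"]
    by (auto simp: Bij_def m_assoc[symmetric] cong: bij_betw_cong)
  then show ?thesis
    by (intro homI) (auto simp: BijGroup_def compose_def m_assoc)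
qed

text \<open>
  The twin group acts on the underlying set of the free product \<open>P\<close> of groups of order two: the
  last generator by left multiplication with the generator \<open>k0\<close> of \<open>P\<close>, and the other generators
  by the automorphisms permuting the generators of \<open>P\<close> according to \<open>\<sigma>\<close>. Then \<open>a k\<close> acts by left
  multiplication with the generator \<open>k\<close>.
\<close>

lemma twin_kernel_group_cong_involution_group:
  fixes \<sigma> :: "nat \<Rightarrow> 'i \<Rightarrow> 'i" and k0 :: 'i
  assumes n: "n > 2" and \<phi>: "twin_projection n \<phi>"
    and \<sigma>_square: "\<And>i k. i \<in> {1..n - 2} \<Longrightarrow> \<sigma> i (\<sigma> i k) = k"
    and \<sigma>_commute: "\<And>i j k. i \<in> {1..n - 2} \<Longrightarrow> j \<in> {1..n - 2} \<Longrightarrow> \<bar>int i - int j\<bar> \<ge> 2 \<Longrightarrow>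
      \<sigma> i (\<sigma> j k) = \<sigma> j (\<sigma> i k)"
    and \<sigma>_fix: "\<And>i. i \<in> {1..n - 2} \<Longrightarrow> i \<noteq> n - 2 \<Longrightarrow> \<sigma> i k0 = k0"
    and orbit: "\<And>Q k. Q k0 \<Longrightarrow> (\<And>i k. i \<in> {1..n - 2} \<Longrightarrow> Q k \<Longrightarrow> Q (\<sigma> i k)) \<Longrightarrow> Q k"
    and a_k0: "a k0 = twin_gen n (n - 1)"
    and a_\<sigma>: "\<And>i k. i \<in> {1..n - 2} \<Longrightarrow>
      a (\<sigma> i k) = twin_gen n i \<otimes>\<^bsub>twin_group n\<^esub> a k \<otimes>\<^bsub>twin_group n\<^esub> twin_gen n i"
  shows "twin_kernel_group n \<phi> \<cong> involution_group (UNIV :: 'i set)"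
proof -
  define T where "T = twin_group n"
  define U where "U = twin_group (n - 1)"
  define P where "P = involution_group (UNIV :: 'i set)"
  define s where "s = twin_gen n"
  define g where "g = involution_gen (UNIV :: 'i set)"
  let ?B = "BijGroup (carrier P)"
  interpret T: group T unfolding T_def by (rule group_twin_group)
  interpret U: group U unfolding U_def by (rule group_twin_group)
  interpret P: group P unfolding P_def by (rule group_involution_group)
  interpret B: group ?B by (rule group_BijGroup)
  have indices: "i \<in> {1..n - 1} \<longleftrightarrow> i \<in> {1..n - 2} \<or> i = n - 1" for i
    using n by auto
  have s_closed [simp]: "s i \<in> carrier T" if "i \<in> {1..n - 2} \<or> i = n - 1" for i
    using twin_gen_closed indices that unfolding s_def T_def by blast
  have s_square: "s i \<otimes>\<^bsub>T\<^esub> s i = \<one>\<^bsub>T\<^esub>" if "i \<in> {1..n - 2} \<or> i = n - 1" for i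
    using twin_gen_square indices that unfolding s_def T_def by blast
  have s_cancel: "s i \<otimes>\<^bsub>T\<^esub> (s i \<otimes>\<^bsub>T\<^esub> x) = x" if "i \<in> {1..n - 2} \<or> i = n - 1" "x \<in> carrier T" for i x
    using s_square[OF that(1)] that by (metis T.l_one T.m_assoc s_closed)
  have g_closed [simp]: "g k \<in> carrier P" for k
    by (simp add: g_def P_def)
  have g_square: "g k \<otimes>\<^bsub>P\<^esub> g k = \<one>\<^bsub>P\<^esub>" for k
    unfolding g_def P_def by (simp add: involution_gen_square)
  have P_hom_eq: "h x = h' x"
    if "group H" "h \<in> hom P H" "h' \<in> hom P H" "\<And>k. h (g k) = h' (g k)" "x \<in> carrier P"
    for H :: "('x, 'y) monoid_scheme" and h h' x
    using that involution_group_hom_eq[of H h UNIV h' x] unfolding P_def g_def by blast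
  interpret \<phi>: group_hom T U \<phi>
    using \<phi> by unfold_locales (simp add: twin_projection_def epi_def T_def U_def)
  have \<phi>_s: "\<phi> (s (n - 1)) = \<one>\<^bsub>U\<^esub>"
    using \<phi> by (simp add: twin_projection_def U_def s_def)

  \<comment> \<open>The conjugates \<open>a k\<close> as involutions in the kernel\<close>
  have a_\<sigma>': "a (\<sigma> i k) = s i \<otimes>\<^bsub>T\<^esub> a k \<otimes>\<^bsub>T\<^esub> s i" if "i \<in> {1..n - 2}" for i k
    using a_\<sigma>[OF that] by (simp add: T_def s_def)
  \<comment> \<open>By \<open>orbit\<close> it suffices to start from the last generator and to pass
    from \<open>a k\<close> to its conjugate by the involution \<open>s i\<close>.\<close>
  have a: "a k \<in> carrier T \<and> a k \<otimes>\<^bsub>T\<^esub> a k = \<one>\<^bsub>T\<^esub> \<and> \<phi> (a k) = \<one>\<^bsub>U\<^esub>" for k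
  proof (rule orbit)
    show "a k0 \<in> carrier T \<and> a k0 \<otimes>\<^bsub>T\<^esub> a k0 = \<one>\<^bsub>T\<^esub> \<and> \<phi> (a k0) = \<one>\<^bsub>U\<^esub>"
      using s_closed[of "n - 1"] s_square[of "n - 1"] \<phi>_s by (simp add: a_k0 s_def)
  next
    fix i k
    assume i: "i \<in> {1..n - 2}"
      and ak: "a k \<in> carrier T \<and> a k \<otimes>\<^bsub>T\<^esub> a k = \<one>\<^bsub>T\<^esub> \<and> \<phi> (a k) = \<one>\<^bsub>U\<^esub>"
    have [simp]: "s i \<in> carrier T" using i by simp
    have ss: "s i \<otimes>\<^bsub>T\<^esub> s i = \<one>\<^bsub>T\<^esub>" using i s_square by blast
    have "a k \<otimes>\<^bsub>T\<^esub> (a k \<otimes>\<^bsub>T\<^esub> s i) = s i"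
      using ak by (simp add: T.m_assoc[symmetric])
    then have "a (\<sigma> i k) \<otimes>\<^bsub>T\<^esub> a (\<sigma> i k) = \<one>\<^bsub>T\<^esub>"
      using ak i ss s_cancel[of i] by (simp add: a_\<sigma>'[OF i] T.m_assoc del: atLeastAtMost_iff)
    moreover have "\<phi> (a (\<sigma> i k)) = \<phi> (s i \<otimes>\<^bsub>T\<^esub> s i)"
      using ak by (simp add: a_\<sigma>'[OF i])
    ultimately show "a (\<sigma> i k) \<in> carrier T \<and> a (\<sigma> i k) \<otimes>\<^bsub>T\<^esub> a (\<sigma> i k) = \<one>\<^bsub>T\<^esub> \<and> \<phi> (a (\<sigma> i k)) = \<one>\<^bsub>U\<^esub>"
      using ak ss by (simp add: a_\<sigma>'[OF i])
  qed
  \<comment> \<open>The candidate isomorphism; it remains to show that \<open>e\<close> is injective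
    with the kernel as image.\<close>
  obtain e where e: "e \<in> hom P T" and e_g: "\<And>k. e (g k) = a k"
    using T.involution_group_lift[of UNIV a] a unfolding P_def g_def by auto
  interpret e: group_hom P T e using e by unfold_locales

  \<comment> \<open>Endomorphisms of the free product induced by \<sigma>\<close>
  have "\<exists>\<alpha> \<in> hom P P. \<forall>k. \<alpha> (g k) = g (\<sigma> i k)" for i
    using P.involution_group_lift[of UNIV "\<lambda>k. g (\<sigma> i k)"] g_square unfolding P_def g_def by auto
  then obtain \<alpha> where \<alpha>: "\<And>i. \<alpha> i \<in> hom P P" and \<alpha>_g: "\<And>i k. \<alpha> i (g k) = g (\<sigma> i k)"
    by metis
  have \<alpha>_closed [simp]: "\<alpha> i x \<in> carrier P" if "x \<in> carrier P" for i x
    using \<alpha>[of i] that by (auto simp: hom_def)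
  have \<alpha>_mult: "\<alpha> i (x \<otimes>\<^bsub>P\<^esub> y) = \<alpha> i x \<otimes>\<^bsub>P\<^esub> \<alpha> i y" if "x \<in> carrier P" "y \<in> carrier P" for i x y
    using \<alpha>[of i] that by (auto simp: hom_def)
  have id: "id \<in> hom P P" by (simp add: hom_def)
  have \<alpha>_square: "\<alpha> i (\<alpha> i x) = x" if "i \<in> {1..n - 2}" "x \<in> carrier P" for i x
    using P_hom_eq[OF P.is_group hom_compose[OF \<alpha> \<alpha>] id _ that(2), of i i] \<sigma>_square[OF that(1)]
    by (simp add: \<alpha>_g)
  have \<alpha>_commute: "\<alpha> i (\<alpha> j x) = \<alpha> j (\<alpha> i x)"
    if "i \<in> {1..n - 2}" "j \<in> {1..n - 2}" "\<bar>int i - int j\<bar> \<ge> 2" "x \<in> carrier P" for i j x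
    using P_hom_eq[OF P.is_group hom_compose[OF \<alpha> \<alpha>] hom_compose[OF \<alpha> \<alpha>] _ that(4), of j i i j]
      \<sigma>_commute[OF that(1-3)]
    by (simp add: \<alpha>_g)

  \<comment> \<open>The action on the free product and injectivity of \<open>e\<close>\<close>
  define L where "L = (\<lambda>p. \<lambda>x\<in>carrier P. p \<otimes>\<^bsub>P\<^esub> x)"
  define A where "A i = (\<lambda>x\<in>carrier P. \<alpha> i x)" for i
  define f where "f i = (if i = n - 1 then L (g k0) else A i)" for i
  have L: "L \<in> hom P ?B"
    unfolding L_def by (rule P.left_mult_hom_BijGroup)
  then have L_closed: "L p \<in> Bij (carrier P)" if "p \<in> carrier P" for p
    using that by (auto simp: hom_def BijGroup_def)
  have A_closed: "A i \<in> Bij (carrier P)" if "i \<in> {1..n - 2}" for i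
    using bij_betw_byWitness[of "carrier P" "\<alpha> i" "\<alpha> i" "carrier P", OF _ _ image_subsetI image_subsetI] \<alpha>_square[OF that] \<alpha>_closed
    by (auto simp: A_def Bij_def cong: bij_betw_cong)
  have mult_B: "F \<otimes>\<^bsub>?B\<^esub> F' = (\<lambda>x\<in>carrier P. F (F' x))"
    if "F \<in> Bij (carrier P)" "F' \<in> Bij (carrier P)" for F F'
    using that by (simp add: BijGroup_def compose_def)
  have one_B: "\<one>\<^bsub>?B\<^esub> = (\<lambda>x\<in>carrier P. x)"
    by (simp add: BijGroup_def)
  have carrier_B: "carrier ?B = Bij (carrier P)"
    by (simp add: BijGroup_def)
  have n1: "n - 1 \<notin> {1..n - 2}"
    using n by auto
  have f_A: "f i = A i" if "i \<in> {1..n - 2}" for i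
    using that n1 by (auto simp: f_def)
  have f_closed: "f i \<in> Bij (carrier P)" if "i \<in> {1..n - 1}" for i
    using that A_closed L_closed f_A unfolding indices by (auto simp: f_def)
  \<comment> \<open>As \<open>\<sigma> i\<close> fixes \<open>k0\<close>, the map
    \<open>\<alpha> i\<close> fixes \<open>g k0\<close> and so commutes with translation by it. This
    is the commutation of the last generator with those of index below \<open>n - 2\<close>.\<close>
  have L_A: "L (g k0) \<otimes>\<^bsub>?B\<^esub> A i = A i \<otimes>\<^bsub>?B\<^esub> L (g k0)" if "i \<in> {1..n - 2}" "i \<noteq> n - 2" for i
    using \<sigma>_fix[OF that] L_closed A_closed[OF that(1)]
    by (auto simp: mult_B L_def A_def \<alpha>_mult \<alpha>_g intro!: restrict_ext)
  have "\<exists>\<psi> \<in> hom T ?B. \<forall>i\<in>{1..n - 1}. \<psi> (s i) = f i"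
    unfolding T_def s_def
  proof (rule B.twin_group_lift)
    fix i
    assume i: "i \<in> {1..n - 1}"
    then show "f i \<in> carrier ?B"
      using f_closed by (simp add: carrier_B)
    show "f i \<otimes>\<^bsub>?B\<^esub> f i = \<one>\<^bsub>?B\<^esub>"
    proof (cases "i = n - 1")
      case True
      then have "f i \<otimes>\<^bsub>?B\<^esub> f i = L (g k0 \<otimes>\<^bsub>P\<^esub> g k0)"
        using hom_mult[OF L, of "g k0" "g k0"] by (simp add: f_def)
      then show ?thesis
        using g_square by (auto simp: L_def one_B intro!: restrict_ext)
    next
      case False
      with i have i: "i \<in> {1..n - 2}" using indices by blast
      show ?thesis
        using A_closed[OF i] \<alpha>_square[OF i]
        by (auto simp: f_A[OF i] mult_B one_B A_def intro!: restrict_ext)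
    qed
  next
    fix i j
    assume i: "i \<in> {1..n - 1}" and j: "j \<in> {1..n - 1}" and ij: "\<bar>int i - int j\<bar> \<ge> 2"
    \<comment> \<open>Distance at least two rules out \<open>i = j = n - 1\<close> and the pair of
      \<open>n - 1\<close> and \<open>n - 2\<close>.\<close>
    consider "i \<in> {1..n - 2}" "j \<in> {1..n - 2}" | "i = n - 1" "j \<in> {1..n - 2}" "j \<noteq> n - 2"
      | "j = n - 1" "i \<in> {1..n - 2}" "i \<noteq> n - 2"
      using i j ij n indices[of i] indices[of j] by linarith
    then show "f i \<otimes>\<^bsub>?B\<^esub> f j = f j \<otimes>\<^bsub>?B\<^esub> f i"
    proof cases
      case 1
      then show ?thesis
        using A_closed \<alpha>_commute[OF 1 ij]
        by (auto simp: f_A mult_B A_def simp del: atLeastAtMost_iff intro!: restrict_ext)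
    next
      case 2
      then show ?thesis using L_A[of j] f_A[of j] by (simp add: f_def)
    next
      case 3
      then show ?thesis using L_A[of i] f_A[of i] by (simp add: f_def)
    qed
  qed
  then obtain \<psi> where \<psi>: "\<psi> \<in> hom T ?B" and \<psi>_s: "\<And>i. i \<in> {1..n - 1} \<Longrightarrow> \<psi> (s i) = f i"
    by blast
  \<comment> \<open>Along the orbit, conjugating the translation by \<open>g k\<close> with the
    involutive automorphism \<open>\<alpha> i\<close> gives the translation by
    \<open>\<alpha> i (g k)\<close>, which is \<open>g (\<sigma> i k)\<close>.\<close>
  have \<psi>_a: "\<psi> (a k) = L (g k)" for k
  proof (rule orbit)
    show "\<psi> (a k0) = L (g k0)"
      using \<psi>_s[of "n - 1"] n by (simp add: a_k0 s_def f_def)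
  next
    fix i k
    assume i: "i \<in> {1..n - 2}" and "\<psi> (a k) = L (g k)"
    then have "\<psi> (a (\<sigma> i k)) = A i \<otimes>\<^bsub>?B\<^esub> L (g k) \<otimes>\<^bsub>?B\<^esub> A i"
      using a \<psi>_s[of i] s_closed[of i] indices[of i]
      by (simp add: a_\<sigma>'[OF i] hom_mult[OF \<psi>] f_A[OF i] del: atLeastAtMost_iff)
    also have "\<dots> = A i \<otimes>\<^bsub>?B\<^esub> (L (g k) \<otimes>\<^bsub>?B\<^esub> A i)"
      using A_closed[OF i] L_closed by (intro B.m_assoc) (auto simp: carrier_B)
    also have "\<dots> = L (g (\<sigma> i k))"
    proof -
      have LA: "L (g k) \<otimes>\<^bsub>?B\<^esub> A i \<in> Bij (carrier P)"
        using B.m_closed[of "L (g k)" "A i"] A_closed[OF i] L_closed[OF g_closed, of k]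
        unfolding carrier_B by blast
      have LA_eq: "L (g k) \<otimes>\<^bsub>?B\<^esub> A i = (\<lambda>x\<in>carrier P. g k \<otimes>\<^bsub>P\<^esub> \<alpha> i x)"
        unfolding mult_B[OF L_closed[OF g_closed] A_closed[OF i]]
        by (rule restrict_ext) (simp add: L_def A_def)
      show ?thesis
        unfolding mult_B[OF A_closed[OF i] LA] unfolding LA_eq unfolding L_def
        by (rule restrict_ext) (simp add: A_def \<alpha>_mult \<alpha>_g \<alpha>_square[OF i])
    qed
    finally show "\<psi> (a (\<sigma> i k)) = L (g (\<sigma> i k))" .
  qed
  have "\<psi> (e p) = L p" if "p \<in> carrier P" for p
    using P_hom_eq[OF B.is_group hom_compose[OF e \<psi>] L _ that] by (simp add: e_g \<psi>_a)
  \<comment> \<open>Translation by \<open>p\<close> takes the neutral element to \<open>p\<close>,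
    so acting on the neutral element is a left inverse of \<open>e\<close>.\<close>
  then have "\<psi> (e p) \<one>\<^bsub>P\<^esub> = p" if "p \<in> carrier P" for p
    using that by (simp add: L_def)
  then have inj: "inj_on e (carrier P)"
    by (intro inj_on_inverseI[where g = "\<lambda>x. \<psi> x \<one>\<^bsub>P\<^esub>"])

  \<comment> \<open>Surjectivity of \<open>e\<close> onto the kernel\<close>
  have \<phi>_e: "\<phi> (e p) = \<one>\<^bsub>U\<^esub>" if "p \<in> carrier P" for p
    using P_hom_eq[OF U.is_group hom_compose[OF e \<phi>.homh] trivial_hom[OF U.is_group] _ that] a
    by (simp add: e_g)
  \<comment> \<open>Conjugation by \<open>s i\<close> is an endomorphism \<open>c\<close>, and
    \<open>c\<close> after \<open>e\<close> agrees with \<open>e\<close> after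
    \<open>\<alpha> i\<close> on generators. Thus \<open>s i\<close> moves past \<open>e p\<close>
    at the cost of applying \<open>\<alpha> i\<close>.\<close>
  have s_e: "s i \<otimes>\<^bsub>T\<^esub> e p = e (\<alpha> i p) \<otimes>\<^bsub>T\<^esub> s i" if i: "i \<in> {1..n - 2}" and p: "p \<in> carrier P" for i p
  proof -
    define c where "c x = s i \<otimes>\<^bsub>T\<^esub> x \<otimes>\<^bsub>T\<^esub> s i" for x
    have si [simp]: "s i \<in> carrier T" using i by simp
    have "c \<in> hom T T"
      using i by (intro homI) (simp_all add: c_def T.m_assoc s_cancel del: atLeastAtMost_iff)
    then have "c (e p) = e (\<alpha> i p)"
      using P_hom_eq[OF T.is_group hom_compose[OF e] hom_compose[OF \<alpha> e] _ p, of c i]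
      by (simp add: e_g \<alpha>_g c_def a_\<sigma>'[OF i])
    then have "e (\<alpha> i p) \<otimes>\<^bsub>T\<^esub> s i = c (e p) \<otimes>\<^bsub>T\<^esub> s i"
      by simp
    also have "\<dots> = s i \<otimes>\<^bsub>T\<^esub> e p \<otimes>\<^bsub>T\<^esub> (s i \<otimes>\<^bsub>T\<^esub> s i)"
      using p by (simp add: c_def T.m_assoc)
    finally show ?thesis
      using p i by (simp add: s_square)
  qed
  define H where "H = twin_subgroup n"
  have semidirect: "subgroup H T" "twin_kernel n \<phi> \<inter> H = {\<one>\<^bsub>T\<^esub>}"
    using twin_group_semidirect[OF \<phi>] by (auto simp: is_semidirect_product_def T_def H_def)
  interpret H: subgroup H T by (rule semidirect(1))
  have sH: "s i \<in> H" if "i \<in> {1..n - 2}" for i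
    unfolding H_def twin_subgroup_def s_def using that by (intro generate.incl) blast
  \<comment> \<open>The products \<open>e p \<otimes> h\<close> are stable under left multiplication
    by generators: the last one is absorbed into \<open>p\<close>, the others move past
    \<open>e p\<close> into \<open>h\<close>. Keeping \<open>p\<close> and \<open>h\<close>
    arbitrary lets a product \<open>x \<otimes> y\<close> act by \<open>y\<close> first and then by
    \<open>x\<close>.\<close>
  have factor: "\<exists>p'\<in>carrier P. \<exists>h'\<in>H. x \<otimes>\<^bsub>T\<^esub> (e p \<otimes>\<^bsub>T\<^esub> h) = e p' \<otimes>\<^bsub>T\<^esub> h'"
    if "x \<in> generate T (s ` {1..n - 1})" "p \<in> carrier P" "h \<in> H" for x p h
  proof -
    have gen: "\<exists>p'\<in>carrier P. \<exists>h'\<in>H. s i \<otimes>\<^bsub>T\<^esub> (e p \<otimes>\<^bsub>T\<^esub> h) = e p' \<otimes>\<^bsub>T\<^esub> h'"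
      if "i \<in> {1..n - 1}" "p \<in> carrier P" "h \<in> H" for i p h
    proof (cases "i = n - 1")
      case True
      have "s i \<otimes>\<^bsub>T\<^esub> (e p \<otimes>\<^bsub>T\<^esub> h) = e (g k0 \<otimes>\<^bsub>P\<^esub> p) \<otimes>\<^bsub>T\<^esub> h"
        using that True a[of k0] by (simp add: e_g a_k0 s_def[symmetric] T.m_assoc)
      with that show ?thesis by (metis P.m_closed g_closed)
    next
      case False
      with that(1) have i: "i \<in> {1..n - 2}" using indices by blast
      then have [simp]: "s i \<in> carrier T" by simp
      have "s i \<otimes>\<^bsub>T\<^esub> (e p \<otimes>\<^bsub>T\<^esub> h) = e (\<alpha> i p) \<otimes>\<^bsub>T\<^esub> (s i \<otimes>\<^bsub>T\<^esub> h)"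
        using that(2,3) s_e[OF i that(2)] by (simp add: T.m_assoc[symmetric])
      moreover have "s i \<otimes>\<^bsub>T\<^esub> h \<in> H"
        using sH[OF i] that(3) by simp
      ultimately show ?thesis using that(2) by (metis \<alpha>_closed)
    qed
    have s_inv: "inv\<^bsub>T\<^esub> s i = s i" if "i \<in> {1..n - 1}" for i
      using that s_square[of i] s_closed[of i] indices[of i] by (intro T.inv_equality) auto
    have gen_closed: "s ` {1..n - 1} \<subseteq> carrier T"
      using s_closed indices by blast
    show ?thesis
      using that
    proof (induction arbitrary: p h rule: generate.induct)
      case one
      then show ?case by (intro bexI[of _ p] bexI[of _ h]) auto
    next
      case (incl x)
      then show ?case using gen by blast
    next
      case (inv x)
      then show ?case using gen s_inv by auto
    next
      case (eng x y)
      have "x \<in> carrier T" "y \<in> carrier T"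
        using eng.hyps T.generate_in_carrier[OF gen_closed] by auto
      moreover obtain p' h' where "p' \<in> carrier P" "h' \<in> H" "y \<otimes>\<^bsub>T\<^esub> (e p \<otimes>\<^bsub>T\<^esub> h) = e p' \<otimes>\<^bsub>T\<^esub> h'"
        using eng.IH(2)[OF eng.prems] by blast
      ultimately show ?case
        using eng.IH(1)[of p' h'] eng.prems by (simp add: T.m_assoc)
    qed
  qed
  have D: "twin_kernel n \<phi> = {x \<in> carrier T. \<phi> x = \<one>\<^bsub>U\<^esub>}"
    by (simp add: twin_kernel_def kernel_def T_def U_def)
  \<comment> \<open>Write \<open>x = e p \<otimes> h\<close>. Since \<phi> kills \<open>x\<close>
    and \<open>e p\<close>, it kills \<open>h\<close>, and the kernel meets \<open>H\<close>
    trivially.\<close>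
  have "x \<in> e ` carrier P" if x: "x \<in> twin_kernel n \<phi>" for x
  proof -
    have xT: "x \<in> carrier T" and \<phi>_x: "\<phi> x = \<one>\<^bsub>U\<^esub>"
      using x by (auto simp: D)
    have "x \<in> generate T (s ` {1..n - 1})"
      using xT by (simp only: T_def s_def generate_twin_group)
    from factor[OF this P.one_closed H.one_closed] xT
    obtain p h where ph: "p \<in> carrier P" "h \<in> H" "x = e p \<otimes>\<^bsub>T\<^esub> h"
      by auto
    then have "\<phi> h = \<one>\<^bsub>U\<^esub>"
      using \<phi>_x \<phi>_e by simp
    then have "h \<in> twin_kernel n \<phi> \<inter> H"
      using ph by (simp add: D)
    then have "h = \<one>\<^bsub>T\<^esub>"
      using semidirect(2) by blast
    with ph show ?thesis by simp
  qed
  then have "e ` carrier P = twin_kernel n \<phi>"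
    using \<phi>_e by (auto simp: D)
  then have "e \<in> iso P (twin_kernel_group n \<phi>)"
    using inj by (auto simp: twin_kernel_group_def iso_def hom_def bij_betw_def T_def[symmetric])
  then have "P \<cong> twin_kernel_group n \<phi>"
    by (rule is_isoI)
  then show ?thesis
    using P.iso_sym by (simp add: P_def)
qed

section \<open>The kernels for three and four strands\<close>

text \<open>The two conjugates of the last generator are indexed by \<open>bool\<close>, with
  \<open>False\<close> for the generator itself; conjugation by the first generator swaps
  them.\<close>

lemma twin_kernel_group_3_cong:
  assumes "twin_projection 3 \<phi>"
  shows "twin_kernel_group 3 \<phi> \<cong> involution_group (UNIV :: bool set)"
proof -
  let ?T = "twin_group 3" and ?s = "twin_gen 3"
  interpret T: group ?T by (rule group_twin_group)
  have s [simp]: "?s 1 \<in> carrier ?T" "?s 2 \<in> carrier ?T"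
    using twin_gen_closed[of _ 3] by auto
  have ss: "?s 1 \<otimes>\<^bsub>?T\<^esub> ?s 1 = \<one>\<^bsub>?T\<^esub>"
    using twin_gen_square[of 1 3] by simp
  define a where "a b = (if b then ?s 1 \<otimes>\<^bsub>?T\<^esub> ?s 2 \<otimes>\<^bsub>?T\<^esub> ?s 1 else ?s 2)" for b
  have cancel: "?s 1 \<otimes>\<^bsub>?T\<^esub> (?s 1 \<otimes>\<^bsub>?T\<^esub> x) = x" if "x \<in> carrier ?T" for x
    using that ss by (metis T.l_one T.m_assoc s(1))
  have a_Not: "a (\<not> b) = ?s 1 \<otimes>\<^bsub>?T\<^esub> a b \<otimes>\<^bsub>?T\<^esub> ?s 1" for b
    using cancel ss by (simp add: a_def T.m_assoc del: One_nat_def)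
  have "Q k" if "Q False" "\<And>i k. i \<in> {1..3 - 2 :: nat} \<Longrightarrow> Q k \<Longrightarrow> Q (\<not> k)" for Q and k :: bool
    using that(1) that(2)[of 1 False] by (cases k) auto
  then show ?thesis
    using a_Not
    by (intro twin_kernel_group_cong_involution_group[OF _ assms, of "\<lambda>_. Not" False a])
      (auto simp: a_def)
qed

text \<open>Conjugation by the involution \<open>x\<close> is an endomorphism that inverts
  \<open>r\<close>, so it inverts every power of \<open>r\<close>.\<close>

lemma (in group) int_pow_conj_involution:
  fixes k :: int
  assumes x: "x \<in> carrier G" "x \<otimes> x = \<one>" and r: "r \<in> carrier G" "x \<otimes> r \<otimes> x = inv r"
  shows "x \<otimes> r [^] k \<otimes> x = inv (r [^] k)"
proof -
  have cancel: "x \<otimes> (x \<otimes> y) = y" if "y \<in> carrier G" for y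
    using that x by (metis l_one m_assoc)
  have "(\<lambda>y. x \<otimes> y \<otimes> x) \<in> hom G G"
    using x cancel by (intro homI) (simp_all add: m_assoc)
  from hom_int_pow[OF this r(1)] r show ?thesis
    by (simp add: is_group int_pow_inv)
qed

text \<open>The first two generators act on the index set \<int> as the reflections of an infinite
  dihedral group, for which \<int> is a single orbit.\<close>

lemma twin_kernel_group_4_cong:
  assumes "twin_projection 4 \<phi>"
  shows "twin_kernel_group 4 \<phi> \<cong> involution_group (UNIV :: int set)"
proof -
  define T where "T = twin_group 4"
  define s where "s = twin_gen 4"
  interpret T: group T unfolding T_def by (rule group_twin_group)
  have s [simp]: "s i \<in> carrier T" if "i \<in> {1, 2, 3}" for i
    unfolding s_def T_def using that by (intro twin_gen_closed) auto
  have ss: "s i \<otimes>\<^bsub>T\<^esub> s i = \<one>\<^bsub>T\<^esub>" if "i \<in> {1, 2, 3}" for i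
    unfolding s_def T_def using that by (intro twin_gen_square) auto
  have cancel: "s i \<otimes>\<^bsub>T\<^esub> (s i \<otimes>\<^bsub>T\<^esub> x) = x" if "i \<in> {1, 2, 3}" "x \<in> carrier T" for i x
    using that ss by (metis T.l_one T.m_assoc s)
  have comm: "s 1 \<otimes>\<^bsub>T\<^esub> s 3 = s 3 \<otimes>\<^bsub>T\<^esub> s 1"
    unfolding s_def T_def by (intro twin_gen_commute) auto
  define r where "r = s 1 \<otimes>\<^bsub>T\<^esub> s 2"
  have r [simp]: "r \<in> carrier T"
    by (simp add: r_def)
  have inv_r: "inv\<^bsub>T\<^esub> r = s 2 \<otimes>\<^bsub>T\<^esub> s 1"
    by (rule T.inv_equality) (simp_all add: r_def T.m_assoc cancel ss)
  have conj_r: "s 1 \<otimes>\<^bsub>T\<^esub> r \<otimes>\<^bsub>T\<^esub> s 1 = inv\<^bsub>T\<^esub> r"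
    unfolding inv_r by (simp add: r_def T.m_assoc cancel)
  define a where "a k = r [^]\<^bsub>T\<^esub> k \<otimes>\<^bsub>T\<^esub> s 3 \<otimes>\<^bsub>T\<^esub> inv\<^bsub>T\<^esub> (r [^]\<^bsub>T\<^esub> k)" for k :: int
  have a_closed [simp]: "a k \<in> carrier T" for k
    by (simp add: a_def)
  have a_neg: "a (- k) = s 1 \<otimes>\<^bsub>T\<^esub> a k \<otimes>\<^bsub>T\<^esub> s 1" for k
  proof -
    have conj: "s 1 \<otimes>\<^bsub>T\<^esub> r [^]\<^bsub>T\<^esub> j \<otimes>\<^bsub>T\<^esub> s 1 = r [^]\<^bsub>T\<^esub> (- j)" for j :: int
      using T.int_pow_conj_involution[OF _ ss r conj_r] by (simp add: T.int_pow_neg)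
    \<comment> \<open>Both outer powers of \<open>r\<close> are rewritten as conjugates by
      \<open>s 1\<close>; the inner copies of \<open>s 1\<close> then cancel across
      \<open>s 3\<close>, with which \<open>s 1\<close> commutes.\<close>
    have "a (- k) = (s 1 \<otimes>\<^bsub>T\<^esub> r [^]\<^bsub>T\<^esub> k \<otimes>\<^bsub>T\<^esub> s 1) \<otimes>\<^bsub>T\<^esub> s 3 \<otimes>\<^bsub>T\<^esub>
        (s 1 \<otimes>\<^bsub>T\<^esub> r [^]\<^bsub>T\<^esub> (- k) \<otimes>\<^bsub>T\<^esub> s 1)"
      unfolding conj by (simp add: a_def T.int_pow_neg)
    also have "\<dots> = s 1 \<otimes>\<^bsub>T\<^esub> r [^]\<^bsub>T\<^esub> k \<otimes>\<^bsub>T\<^esub> (s 1 \<otimes>\<^bsub>T\<^esub> s 3) \<otimes>\<^bsub>T\<^esub> s 1 \<otimes>\<^bsub>T\<^esub>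
        r [^]\<^bsub>T\<^esub> (- k) \<otimes>\<^bsub>T\<^esub> s 1"
      by (simp add: T.m_assoc)
    also have "\<dots> = s 1 \<otimes>\<^bsub>T\<^esub> a k \<otimes>\<^bsub>T\<^esub> s 1"
      unfolding comm by (simp add: a_def T.m_assoc cancel T.int_pow_neg)
    finally show ?thesis .
  qed
  have a_Suc: "a (k + 1) = r \<otimes>\<^bsub>T\<^esub> a k \<otimes>\<^bsub>T\<^esub> inv\<^bsub>T\<^esub> r" for k
    using T.int_pow_mult[OF r, of 1 k]
    by (simp add: a_def add.commute T.inv_mult_group T.m_assoc)
  \<comment> \<open>Combine the shift by \<open>r\<close> with the reflection by \<open>s 1\<close>:
    the product of \<open>s 1\<close> and \<open>r\<close> is \<open>s 2\<close>, and so is that of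
    the inverse of \<open>r\<close> and \<open>s 1\<close>.\<close>
  have a_s2: "a (- k - 1) = s 2 \<otimes>\<^bsub>T\<^esub> a k \<otimes>\<^bsub>T\<^esub> s 2" for k
    using a_neg[of "k + 1"] by (simp add: a_Suc inv_r) (simp add: r_def T.m_assoc cancel ss)
  define \<sigma> :: "nat \<Rightarrow> int \<Rightarrow> int" where "\<sigma> i k = (if i = 1 then - k else - k - 1)" for i k
  have indices: "i \<in> {1..4 - 2} \<longleftrightarrow> i = 1 \<or> i = 2" for i :: nat
    by auto
  have orbit: "Q k" if Q: "Q 0" "\<And>i k. i \<in> {1..4 - 2} \<Longrightarrow> Q k \<Longrightarrow> Q (\<sigma> i k)" for Q and k :: int
  proof (induction k rule: int_induct[where k = 0])
    case base
    show ?case by (rule Q(1))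
  next
    case (step1 k)
    \<comment> \<open>The two reflections compose to the shift by one, upwards here and downwards in
      the opposite order below.\<close>
    from Q(2)[of 1 "\<sigma> 2 k"] Q(2)[of 2 k] step1 show ?case by (simp add: \<sigma>_def add.commute)
  next
    case (step2 k)
    from Q(2)[of 2 "\<sigma> 1 k"] Q(2)[of 1 k] step2 show ?case by (simp add: \<sigma>_def)
  qed
  show ?thesis
  proof (rule twin_kernel_group_cong_involution_group[OF _ assms, of \<sigma> 0 a])
    show "a (\<sigma> i k) = twin_gen 4 i \<otimes>\<^bsub>twin_group 4\<^esub> a k \<otimes>\<^bsub>twin_group 4\<^esub> twin_gen 4 i"
      if "i \<in> {1..4 - 2}" for i k
      using that a_neg[of k] a_s2[of k] unfolding indices \<sigma>_def T_def s_def by auto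
    show "a 0 = twin_gen 4 (4 - 1)"
      by (simp add: a_def) (simp add: s_def)
    show "Q k" if "Q 0" "\<And>i k. i \<in> {1..4 - 2} \<Longrightarrow> Q k \<Longrightarrow> Q (\<sigma> i k)" for Q and k :: int
      using that by (rule orbit)
  qed (auto simp: \<sigma>_def)
qed

text \<open>The indices 1 and 2 are too close for a commutation relation, so only the two relations
  making the generators involutions remain.\<close>

lemma involution_group_bool_cong_twin_group_3:
  "involution_group (UNIV :: bool set) \<cong> twin_group 3"
proof -
  have "{([(i, True), (j, True)], [(j, True), (i, True)]) | i j.
      i \<in> {1..3 - 1 :: nat} \<and> j \<in> {1..3 - 1} \<and> \<bar>int i - int j\<bar> \<ge> 2} = {}"
    by auto
  then have T: "twin_group 3 = involution_group {1..3 - 1}"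
    by (simp only: twin_group_def involution_group_def twin_rels_def involution_rels_def Un_empty_right)
  have "bij_betw (\<lambda>b. if b then 1 else 2) UNIV {1..3 - 1 :: nat}"
    by (auto simp: bij_betw_def inj_on_def UNIV_bool)
  then show ?thesis
    unfolding T by (rule involution_group_cong_bij)
qed

text \<open>A projection is determined only on the carrier, so the claims range over all \<phi>; the
  first conjunct ensures that such a \<phi> exists. The second identifies the smaller twin group
  with the subgroup used as complement.\<close>

theorem proposition2p1:
  "(\<forall>n>2. \<exists>\<phi>. twin_projection n \<phi>) \<and>
   (\<forall>n>2. \<exists>\<iota>. \<iota> \<in> iso (twin_group (n - 1)) ((twin_group n)\<lparr>carrier := twin_subgroup n\<rparr>) \<and>
      (\<forall>i\<in>{1..n - 2}. \<iota> (twin_gen (n - 1) i) = twin_gen n i)) \<and>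
   (\<forall>n>2. \<forall>\<phi>. twin_projection n \<phi> \<longrightarrow>
      is_semidirect_product (twin_group n) (twin_kernel n \<phi>) (twin_subgroup n)) \<and>
   (\<forall>\<phi>. twin_projection 3 \<phi> \<longrightarrow>
      twin_kernel_group 3 \<phi> \<cong> free_product2 (integer_mod_group 2) (integer_mod_group 2)) \<and>
   free_product2 (integer_mod_group 2) (integer_mod_group 2) \<cong> twin_group 3 \<and>
   (\<forall>\<phi>. twin_projection 4 \<phi> \<longrightarrow>
      twin_kernel_group 4 \<phi> \<cong>
        presented_group (UNIV :: int set) {([(k, True), (k, True)], []) | k. k \<in> UNIV} \<and>
      twin_kernel_group 4 \<phi> \<cong> free_product (UNIV :: int set) (\<lambda>_. integer_mod_group 2))"
proof (intro conjI allI impI)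
  fix n :: nat
  assume n: "n > 2"
  then show "\<exists>\<phi>. twin_projection n \<phi>"
    by (rule twin_projection_exists)
  show "\<exists>\<iota>. \<iota> \<in> iso (twin_group (n - 1)) ((twin_group n)\<lparr>carrier := twin_subgroup n\<rparr>) \<and>
      (\<forall>i\<in>{1..n - 2}. \<iota> (twin_gen (n - 1) i) = twin_gen n i)"
    using twin_inclusion_exists[of n] twin_inclusion_iso[OF n] by blast
next
  fix n :: nat and \<phi>
  assume "twin_projection n \<phi>"
  then show "is_semidirect_product (twin_group n) (twin_kernel n \<phi>) (twin_subgroup n)"
    by (rule twin_group_semidirect)
next
  have F: "free_product2 (integer_mod_group 2) (integer_mod_group 2) =
      free_product UNIV (\<lambda>_. integer_mod_group 2)"
    by (simp add: free_product2_def)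
  show "twin_kernel_group 3 \<phi> \<cong> free_product2 (integer_mod_group 2) (integer_mod_group 2)"
    if "twin_projection 3 \<phi>" for \<phi>
    unfolding F using twin_kernel_group_3_cong[OF that] involution_group_cong_free_product by (rule iso_trans)
  show "free_product2 (integer_mod_group 2) (integer_mod_group 2) \<cong> twin_group 3"
    unfolding F
    using group.iso_sym[OF group_involution_group involution_group_cong_free_product]
      involution_group_bool_cong_twin_group_3 by (rule iso_trans)
next
  fix \<phi>
  assume "twin_projection 4 \<phi>"
  note kernel = twin_kernel_group_4_cong[OF this]
  from kernel show "twin_kernel_group 4 \<phi> \<cong>
      presented_group (UNIV :: int set) {([(k, True), (k, True)], []) | k. k \<in> UNIV}"
    by (simp only: involution_group_def involution_rels_def)
  show "twin_kernel_group 4 \<phi> \<cong> free_product (UNIV :: int set) (\<lambda>_. integer_mod_group 2)"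
    using kernel involution_group_cong_free_product by (rule iso_trans)
qed

end
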